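(* Let $g,h\ge 0$ and $m\ge 2$ be integers and $n=g+h+m$. Let $G$ be the path-clique-path graph obtained from the complete graph $K_m$ with two distinct chosen vertices $u,v$ by attaching a pendant path of length $g$ at $u$ and a pendant path of length $h$ at $v$ (the paths being vertex-disjoint apart from their endpoints in $K_m$; so $G$ has $n$ vertices). Then \[ \frac{X_{G}}{(m-2)!}=(m-1)e_n+\sum_{\substack{I\vDash n\\ \Theta_I(h+1)\ge m-1}} (m-2)\, i_{-1}\, w_{I\backslash i_{-1}}\, e_I+\sum_{\substack{I\vDash n\\ i_{-1}\ge m-1}} (i_{-1}-m+1)\, w_{I\backslash i_{-1}}\, e_I, \] and all coefficients in this expansion are nonnegative.
   Context: All graphs are finite simple graphs. The chromatic symmetric function of a graph $G$ is $X_G=\sum_{\kappa}\prod_{v\in V(G)}x_{\kappa(v)}$, where $\kappa$ ranges over proper colorings $\kappa:V(G)\to\{1,2,\dots\}$. $e_k$ is the $k$-th elementary symmetric function. A composition $I=i_1\dotsm i_\ell$ of $n$ ($I\vDash n$) is a sequence of positive integers with sum $n$; $\ell(I)=\ell$; $i_{-1}=i_\ell$ is the last part and $I\backslash i_{-1}=i_1\dotsm i_{\ell-1}$. Define $e_I=e_{i_1}\dotsm e_{i_\ell}$ and $w_I=i_1(i_2-1)\dotsm(i_\ell-1)$, with $w$ of the empty composition equal to $1$. For a number $t\le n$, $\sigma_I(t)=\min\{i_1+\dots+i_j:0\le j\le\ell(I),\ i_1+\dots+i_j\ge t\}$ and $\Theta_I(t)=\sigma_I(t)-t$. *)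

theory Defs
  imports Complex_Main "HOL-Library.FuncSet" "HOL-Library.Poly_Mapping"
begin

text \<open>Symmetric functions (formal power series in the variables x_1, x_2, ...),
 represented by their coefficient function on monomials.  A monomial is a
 finitely supported exponent vector alpha :: nat =>0 nat; variable index i stands
 for x_(i+1).\<close>

type_synonym sf = "(nat \<Rightarrow>\<^sub>0 nat) \<Rightarrow> real"

definition sf_one :: sf where
  "sf_one \<alpha> = (if \<alpha> = 0 then 1 else 0)"

definition sf_mult :: "sf \<Rightarrow> sf \<Rightarrow> sf" where
  "sf_mult f g \<alpha> = (\<Sum>(\<beta>,\<gamma>) \<in> {(\<beta>,\<gamma>). \<beta> + \<gamma> = \<alpha>}. f \<beta> * g \<gamma>)"

definition elem_sf :: "nat \<Rightarrow> sf" where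
  "elem_sf k \<alpha> = (if (\<forall>i. Poly_Mapping.lookup \<alpha> i \<le> 1) \<and> (\<Sum>i\<in>Poly_Mapping.keys \<alpha>. Poly_Mapping.lookup \<alpha> i) = k then 1 else 0)"

definition elem_sf_comp :: "nat list \<Rightarrow> sf" where
  "elem_sf_comp I = foldr sf_mult (map elem_sf I) sf_one"

definition chrom_sf :: "'a set \<Rightarrow> ('a \<Rightarrow> 'a \<Rightarrow> bool) \<Rightarrow> sf" where
  "chrom_sf V E \<alpha> = real (card {\<kappa> \<in> V \<rightarrow>\<^sub>E (UNIV :: nat set).
      (\<forall>x\<in>V. \<forall>y\<in>V. E x y \<longrightarrow> \<kappa> x \<noteq> \<kappa> y) \<and>
      (\<forall>i. card {v\<in>V. \<kappa> v = i} = Poly_Mapping.lookup \<alpha> i)})"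

definition compositions :: "nat \<Rightarrow> nat list set" where
  "compositions n = {I. (\<forall>x\<in>set I. 0 < x) \<and> sum_list I = n}"

fun w_comp :: "nat list \<Rightarrow> nat" where
  "w_comp [] = 1"
| "w_comp (i # rest) = i * prod_list (map (\<lambda>x. x - 1) rest)"

definition sigma_comp :: "nat list \<Rightarrow> nat \<Rightarrow> nat" where
  "sigma_comp I t = Min {sum_list (take j I) | j. j \<le> length I \<and> sum_list (take j I) \<ge> t}"

definition Theta_comp :: "nat list \<Rightarrow> nat \<Rightarrow> nat" where
  "Theta_comp I t = sigma_comp I t - t"

text \<open>Path-clique-path graph on vertices {0..<g+h+m}: path 0-1-...-g, clique on
 {g,...,g+m-1} (u = g, v = g+m-1), path (g+m-1)-...-(g+m-1+h).\<close>
definition pcp_vertices :: "nat \<Rightarrow> nat \<Rightarrow> nat \<Rightarrow> nat set" where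
  "pcp_vertices g h m = {0..<g+h+m}"

definition pcp_edge :: "nat \<Rightarrow> nat \<Rightarrow> nat \<Rightarrow> nat \<Rightarrow> nat \<Rightarrow> bool" where
  "pcp_edge g h m x y \<longleftrightarrow> x \<noteq> y \<and> x < g+h+m \<and> y < g+h+m \<and>
     ((g \<le> x \<and> x < g+m \<and> g \<le> y \<and> y < g+m)
      \<or> ((x < g \<or> g+m-1 \<le> x) \<and> y = x + 1)
      \<or> ((y < g \<or> g+m-1 \<le> y) \<and> x = y + 1))"

end

theory Submission
  imports Defs
begin

text \<open>
  Restricting to finitely many colours turns everything into an identity between polynomials.
  Let \<open>W\<^sub>g(a)\<close> be the generating function of coloured paths with \<open>g + 1\<close> vertices starting in
  colour \<open>a\<close>, and \<open>p\<^sub>k\<close> that of all coloured paths with \<open>k\<close> vertices.  With \<open>k = m - 2\<close>, the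
  quotient \<open>X\<^sub>G / k!\<close> is the sum of \<open>W\<^sub>g(a) W\<^sub>h(b) e\<^sub>k(C - {a, b})\<close> over \<open>a \<noteq> b\<close>.
  Since \<open>W\<^sub>g\<^sub>+\<^sub>1(a) = x\<^sub>a (p\<^sub>g\<^sub>+\<^sub>1 - W\<^sub>g(a))\<close> and
  \<open>(x\<^sub>b - x\<^sub>a) e\<^sub>k(C - {a, b}) = e\<^sub>k\<^sub>+\<^sub>1(C - {a}) - e\<^sub>k\<^sub>+\<^sub>1(C - {b})\<close>, moving one vertex from one path
  to the other changes this sum by \<open>k (p\<^sub>g\<^sub>+\<^sub>1 Y\<^sub>h - p\<^sub>h\<^sub>+\<^sub>1 Y\<^sub>g)\<close>, where \<open>Y\<^sub>h\<close> is the normalised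
  lollipop function; for \<open>h = 0\<close> the graph itself is a lollipop.  The right-hand side changes by
  the same amount: a composition satisfying the condition on \<open>\<Theta>\<close> for only one of \<open>h\<close> and \<open>h + 1\<close>
  can be cut at a partial sum into two compositions counted by a \<open>p\<close> and a \<open>Y\<close>.
\<close>

section \<open>Generating functions of paths, lollipops and path-clique-path graphs\<close>

text \<open>The weights lie in an arbitrary commutative ring, so the identities are purely
  algebraic; at the end \<open>x\<close> becomes the variables of a polynomial ring and
  \<open>C\<close> a finite set of colours.\<close>

locale color_weights =
  fixes C :: "'c set" and x :: "'c \<Rightarrow> 'a :: comm_ring_1"
  assumes finC: "finite C"
begin

definition esym :: "'c set \<Rightarrow> nat \<Rightarrow> 'a" where
  "esym A k = (\<Sum>S | S \<subseteq> A \<and> card S = k. \<Prod>i\<in>S. x i)"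

fun walk :: "nat \<Rightarrow> 'c \<Rightarrow> 'a" where
  "walk 0 c = x c"
| "walk (Suc k) c = x c * (\<Sum>d\<in>C - {c}. walk k d)"

definition pathp :: "nat \<Rightarrow> 'a" where
  "pathp n = (case n of 0 \<Rightarrow> 1 | Suc k \<Rightarrow> \<Sum>c\<in>C. walk k c)"

text \<open>This is the lollipop made of \<open>K_(k+1)\<close> and a pendant path of length
  \<open>h\<close>, divided by \<open>k!\<close>: \<open>b\<close> colours the attaching vertex and
  \<open>esym\<close> picks the unordered colour set of the other \<open>k\<close> clique vertices.
  The \<open>Y_h\<close> of the overview is \<open>lolli h (m - 1)\<close>.\<close>

definition lolli :: "nat \<Rightarrow> nat \<Rightarrow> 'a" where
  "lolli h k = (\<Sum>b\<in>C. walk h b * esym (C - {b}) k)"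

text \<open>The clique here has \<open>k + 2\<close> vertices: \<open>a\<close> and \<open>b\<close>
  are the colours of its two attaching vertices, and the other \<open>k\<close> are normalised by
  \<open>k!\<close>.\<close>

definition pcp :: "nat \<Rightarrow> nat \<Rightarrow> nat \<Rightarrow> 'a" where
  "pcp g h k = (\<Sum>a\<in>C. \<Sum>b\<in>C - {a}. walk g a * walk h b * esym (C - {a, b}) k)"

section \<open>Elementary symmetric polynomials with a colour removed\<close>

lemma esym_0 [simp]: "finite A \<Longrightarrow> esym A 0 = 1"
proof -
  assume "finite A"
  then have "{S. S \<subseteq> A \<and> card S = 0} = {{}}"
    using finite_subset by fastforce
  then show ?thesis by (simp add: esym_def)
qed

lemma esym_remove:
  assumes "finite A" "a \<in> A"
  shows "esym A (Suc k) = esym (A - {a}) (Suc k) + x a * esym (A - {a}) k"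
proof -
  let ?U = "{S. S \<subseteq> A - {a} \<and> card S = Suc k}"
  let ?W = "{S. S \<subseteq> A - {a} \<and> card S = k}"
  have fin: "finite S" if "S \<subseteq> A" for S using that assms finite_subset by blast
  have "{S. S \<subseteq> A \<and> card S = Suc k} = ?U \<union> insert a ` ?W"
  proof (intro equalityI subsetI)
    fix S assume S: "S \<in> {S. S \<subseteq> A \<and> card S = Suc k}"
    show "S \<in> ?U \<union> insert a ` ?W"
    proof (cases "a \<in> S")
      case True
      then have "S = insert a (S - {a})" by blast
      moreover have "S - {a} \<in> ?W" using S True fin by auto
      ultimately show ?thesis by blast
    qed (use S in auto)
  next
    fix S assume S: "S \<in> ?U \<union> insert a ` ?W"
    show "S \<in> {S. S \<subseteq> A \<and> card S = Suc k}"
    proof (cases "S \<in> ?U")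
      case False
      then obtain T where T: "S = insert a T" "T \<in> ?W" using S by blast
      then have "finite T" "a \<notin> T" using fin by auto
      then show ?thesis using T assms by auto
    qed auto
  qed
  then have "esym A (Suc k) = (\<Sum>S\<in>?U. \<Prod>i\<in>S. x i) + (\<Sum>S\<in>insert a ` ?W. \<Prod>i\<in>S. x i)"
    unfolding esym_def using assms by (subst sum.union_disjoint[symmetric]) auto
  also have "(\<Sum>S\<in>insert a ` ?W. \<Prod>i\<in>S. x i) = (\<Sum>S\<in>?W. \<Prod>i\<in>insert a S. x i)"
    by (subst sum.reindex) (auto simp: inj_on_def)
  also have "\<dots> = (\<Sum>S\<in>?W. x a * (\<Prod>i\<in>S. x i))"
  proof (intro sum.cong refl)
    fix S assume "S \<in> ?W"
    then have "finite S" "a \<notin> S" using fin by auto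
    then show "(\<Prod>i\<in>insert a S. x i) = x a * (\<Prod>i\<in>S. x i)" by simp
  qed
  finally show ?thesis by (simp add: esym_def sum_distrib_left)
qed

text \<open>Double counting of pairs \<open>(S, a)\<close> with \<open>a\<close> in
  \<open>S\<close>: every set of size \<open>k + 1\<close> arises once for each of its
  elements.\<close>

lemma sum_esym_remove:
  assumes "finite A"
  shows "(\<Sum>a\<in>A. x a * esym (A - {a}) k) = of_nat (Suc k) * esym A (Suc k)"
proof -
  let ?W = "\<lambda>a. {S. S \<subseteq> A - {a} \<and> card S = k}"
  let ?U = "{S. S \<subseteq> A \<and> card S = Suc k}"
  have fin: "finite S" if "S \<subseteq> A" for S using that assms finite_subset by blast
  have "(\<Sum>a\<in>A. x a * esym (A - {a}) k) = (\<Sum>a\<in>A. \<Sum>S\<in>?W a. x a * (\<Prod>i\<in>S. x i))"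
    by (simp add: esym_def sum_distrib_left)
  also have "\<dots> = (\<Sum>(a, S)\<in>(SIGMA a:A. ?W a). x a * (\<Prod>i\<in>S. x i))"
    using assms by (subst sum.Sigma) auto
  also have "\<dots> = (\<Sum>(S, a)\<in>(SIGMA S:?U. S). \<Prod>i\<in>S. x i)"
  proof (rule sum.reindex_bij_witness[where i = "\<lambda>(S, a). (a, S - {a})" and j = "\<lambda>(a, S). (insert a S, a)"], goal_cases)
    case (1 p) then show ?case by (auto simp: insert_absorb)
  next
    case (2 p)
    then obtain a S where p: "p = (a, S)" "a \<in> A" "S \<subseteq> A - {a}" "card S = k" by auto
    then have "finite S" "a \<notin> S" using fin by auto
    with p show ?case by auto
  next
    case (3 p) then show ?case by auto
  next
    case (4 p)
    then obtain S a where p: "p = (S, a)" "a \<in> S" "S \<subseteq> A" "card S = Suc k" by auto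
    with fin show ?case by auto
  next
    case (5 p)
    then obtain a S where p: "p = (a, S)" "a \<in> A" "S \<subseteq> A - {a}" "card S = k" by auto
    then have "finite S" "a \<notin> S" using fin by auto
    with p show ?case by auto
  qed
  also have "\<dots> = (\<Sum>S\<in>?U. \<Sum>a\<in>S. \<Prod>i\<in>S. x i)"
    using assms fin by (subst sum.Sigma) auto
  also have "\<dots> = of_nat (Suc k) * esym A (Suc k)"
    by (simp add: esym_def sum_distrib_left)
  finally show ?thesis .
qed

section \<open>Recursion and expansion of the lollipop functions\<close>

lemma pathp_0 [simp]: "pathp 0 = 1"
  and pathp_Suc: "pathp (Suc k) = (\<Sum>c\<in>C. walk k c)"
  by (simp_all add: pathp_def)

text \<open>The sum over all colours other than \<open>c\<close> is the full sum minus its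
  \<open>c\<close> term.\<close>

lemma walk_Suc: "c \<in> C \<Longrightarrow> walk (Suc k) c = x c * (pathp (Suc k) - walk k c)"
  by (simp add: pathp_Suc sum_diff1 finC)

lemma lolli_k0: "lolli h 0 = pathp (Suc h)"
  by (simp add: lolli_def pathp_Suc finC)

lemma lolli_0: "lolli 0 k = of_nat (Suc k) * esym C (Suc k)"
  using sum_esym_remove[OF finC] by (simp add: lolli_def)

text \<open>A path vertex is traded for a clique vertex. The coefficient \<open>k\<close> is
  \<open>k + 1\<close> from \<open>sum_esym_remove\<close> minus the 1 from replacing
  \<open>x b * esym (C - {b}) k\<close> by
  \<open>esym C (Suc k) - esym (C - {b}) (Suc k)\<close>.\<close>

lemma lolli_Suc: "lolli (Suc h) k = of_nat k * esym C (Suc k) * pathp (Suc h) + lolli h (Suc k)"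
proof -
  have "lolli (Suc h) k = (\<Sum>b\<in>C. pathp (Suc h) * (x b * esym (C - {b}) k)
      - walk h b * (x b * esym (C - {b}) k))"
    unfolding lolli_def by (intro sum.cong refl) (subst walk_Suc, simp_all add: algebra_simps)
  also have "\<dots> = (\<Sum>b\<in>C. pathp (Suc h) * (x b * esym (C - {b}) k)
      - walk h b * (esym C (Suc k) - esym (C - {b}) (Suc k)))"
  proof (intro sum.cong refl)
    fix b assume "b \<in> C"
    from esym_remove[OF finC this, of k]
    have "x b * esym (C - {b}) k = esym C (Suc k) - esym (C - {b}) (Suc k)" by simp
    then show "pathp (Suc h) * (x b * esym (C - {b}) k) - walk h b * (x b * esym (C - {b}) k)
      = pathp (Suc h) * (x b * esym (C - {b}) k)
      - walk h b * (esym C (Suc k) - esym (C - {b}) (Suc k))" by simp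
  qed
  also have "\<dots> = pathp (Suc h) * (\<Sum>b\<in>C. x b * esym (C - {b}) k)
      - (\<Sum>b\<in>C. walk h b) * esym C (Suc k) + lolli h (Suc k)"
    by (simp add: lolli_def sum_subtractf sum_distrib_left sum_distrib_right right_diff_distrib)
  also have "\<dots> = of_nat k * esym C (Suc k) * pathp (Suc h) + lolli h (Suc k)"
    by (simp add: sum_esym_remove[OF finC] pathp_Suc algebra_simps)
  finally show ?thesis .
qed

text \<open>Iterate \<open>lolli_Suc\<close> until the path has length 0. There
  \<open>lolli_0\<close> gives coefficient \<open>i\<close> instead of \<open>i - 1\<close> at
  \<open>i = h + k + 1\<close>, which is the separate first term.\<close>

lemma lolli_expand:
  "lolli h k = esym C (h + Suc k)
    + (\<Sum>i=Suc k..h + Suc k. of_nat (i - 1) * esym C i * pathp (h + Suc k - i))"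
proof (induction h arbitrary: k)
  case 0
  show ?case by (simp add: lolli_0 algebra_simps)
next
  case (Suc h)
  show ?case
    by (subst sum.atLeast_Suc_atMost) (simp_all add: lolli_Suc Suc.IH algebra_simps)
qed

section \<open>Moving a vertex from one path to the other\<close>

lemma sum_offdiag_swap:
  "(\<Sum>a\<in>C. \<Sum>b\<in>C - {a}. f a b) = (\<Sum>b\<in>C. \<Sum>a\<in>C - {b}. (f a b :: 'a))"
  by (simp add: sum_diff1 finC sum_subtractf sum.swap[of f])

text \<open>Without a path at \<open>u\<close> the graph is a lollipop, in which \<open>u\<close> is
  an ordinary clique vertex; the factor is \<open>(k+1)! / k!\<close>, the quotient of the two
  normalisations.\<close>

lemma pcp_0: "pcp 0 h k = of_nat (Suc k) * lolli h (Suc k)"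
proof -
  have "pcp 0 h k = (\<Sum>b\<in>C. \<Sum>a\<in>C - {b}. x a * walk h b * esym (C - {a, b}) k)"
    unfolding pcp_def walk.simps by (rule sum_offdiag_swap)
  also have "\<dots> = (\<Sum>b\<in>C. walk h b * (\<Sum>a\<in>C - {b}. x a * esym (C - {b} - {a}) k))"
    by (simp add: sum_distrib_left mult_ac Diff_insert2[symmetric] insert_commute)
  also have "\<dots> = of_nat (Suc k) * lolli h (Suc k)"
    using finC by (simp add: sum_esym_remove lolli_def sum_distrib_left mult_ac del: of_nat_Suc)
  finally show ?thesis .
qed

lemma pcp_commute: "pcp g h k = pcp h g k"
  unfolding pcp_def by (subst sum_offdiag_swap) (simp add: mult_ac insert_commute)

text \<open>Expanding the longer walk by \<open>walk_Suc\<close> gives \<open>k + 1\<close> copies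
  of each product of a path and a lollipop, through \<open>pcp_0\<close>. The remaining terms carry
  \<open>walk g a * walk h b\<close> times a difference of the form \<open>F a - F b\<close>, and
  their sum cancels one copy of each.\<close>

lemma pcp_shift:
  "pcp (Suc g) h k = pcp g (Suc h) k
    + of_nat k * (pathp (Suc g) * lolli h (Suc k) - pathp (Suc h) * lolli g (Suc k))"
proof -
  let ?E = "\<lambda>a b. esym (C - {a, b}) k"
  let ?e = "\<lambda>a. esym (C - {a}) (Suc k)"
  have step: "walk (Suc g) a * walk h b * ?E a b - walk g a * walk (Suc h) b * ?E a b
      = pathp (Suc g) * (x a * walk h b * ?E a b) - pathp (Suc h) * (walk g a * x b * ?E a b)
        + walk g a * walk h b * (?e a - ?e b)"
    if "a \<in> C" "b \<in> C - {a}" for a b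
  proof -
    have "?e a = esym (C - {a, b}) (Suc k) + x b * ?E a b"
      using that finC esym_remove[of "C - {a}" b k] by (simp add: Diff_insert2[symmetric] insert_commute)
    moreover have "?e b = esym (C - {a, b}) (Suc k) + x a * ?E a b"
      using that finC esym_remove[of "C - {b}" a k] by (auto simp: Diff_insert2[symmetric] insert_commute)
    ultimately have e: "?e a - ?e b = x b * ?E a b - x a * ?E a b" by simp
    have "b \<in> C" using that by simp
    with that(1) show ?thesis
      unfolding e by (simp add: walk_Suc algebra_simps del: walk.simps)
  qed
  \<comment> \<open>The summand vanishes for \<open>a = b\<close>, so the diagonal may be added; the
    double sum then factors.\<close>
  have diag: "(\<Sum>a\<in>C. \<Sum>b\<in>C - {a}. walk g a * walk h b * (?e a - ?e b))
      = (\<Sum>a\<in>C. \<Sum>b\<in>C. walk g a * walk h b * (?e a - ?e b))"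
    by (simp add: sum_diff1 finC)
  have "pcp (Suc g) h k - pcp g (Suc h) k
      = (\<Sum>a\<in>C. \<Sum>b\<in>C - {a}. pathp (Suc g) * (x a * walk h b * ?E a b)
          - pathp (Suc h) * (walk g a * x b * ?E a b) + walk g a * walk h b * (?e a - ?e b))"
    unfolding pcp_def sum_subtractf[symmetric] by (intro sum.cong refl step)
  also have "\<dots> = pathp (Suc g) * pcp 0 h k - pathp (Suc h) * pcp g 0 k
      + (\<Sum>a\<in>C. \<Sum>b\<in>C - {a}. walk g a * walk h b * (?e a - ?e b))"
    by (simp add: pcp_def sum.distrib sum_subtractf sum_distrib_left)
  also have "(\<Sum>a\<in>C. \<Sum>b\<in>C - {a}. walk g a * walk h b * (?e a - ?e b))
      = (\<Sum>a\<in>C. walk g a * ?e a) * (\<Sum>b\<in>C. walk h b) - (\<Sum>a\<in>C. walk g a) * (\<Sum>b\<in>C. walk h b * ?e b)"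
    unfolding diag sum_product sum_subtractf[symmetric] by (simp add: algebra_simps)
  also have "\<dots> = lolli g (Suc k) * pathp (Suc h) - pathp (Suc g) * lolli h (Suc k)"
    by (simp add: lolli_def pathp_Suc)
  finally have "pcp (Suc g) h k - pcp g (Suc h) k = pathp (Suc g) * pcp 0 h k - pathp (Suc h) * pcp g 0 k
      + (lolli g (Suc k) * pathp (Suc h) - pathp (Suc g) * lolli h (Suc k))" .
  then show ?thesis
    by (simp add: pcp_commute[of g 0] pcp_0 algebra_simps)
qed

end

section \<open>Compositions\<close>

lemma compositions_0 [simp]: "compositions 0 = {[]}"
  by (auto simp: compositions_def) (metis list.set_intros(1) neq_Nil_conv not_less0)

lemma Nil_in_compositions_iff [simp]: "[] \<in> compositions n \<longleftrightarrow> n = 0"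
  by (auto simp: compositions_def)

lemma compositions_nonempty: "I \<in> compositions n \<Longrightarrow> 0 < n \<Longrightarrow> I \<noteq> []"
  by (auto simp: compositions_def)

lemma finite_compositions [simp]: "finite (compositions n)"
proof (rule finite_subset)
  have "length I \<le> sum_list I" if "\<forall>x\<in>set I. 0 < x" for I :: "nat list"
    using that by (induction I) auto
  then show "compositions n \<subseteq> {I. set I \<subseteq> {..n} \<and> length I \<le> n}"
    by (auto simp: compositions_def member_le_sum_list)
  show "finite {I. set I \<subseteq> {..n} \<and> length I \<le> n}"
    by (rule finite_lists_length_le) simp
qed

lemma sum_compositions_rev:
  "(\<Sum>I | I \<in> compositions n \<and> P (rev I). f (rev I)) = (\<Sum>I | I \<in> compositions n \<and> P I. f I)"
  by (rule sum.reindex_bij_witness[where i = rev and j = rev]) (auto simp: compositions_def)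

text \<open>Composition of \<open>n\<close> are sorted by their last part. Positivity of
  \<open>n\<close> excludes the empty list, whose \<open>last\<close> is unspecified, and positivity
  of \<open>m\<close> keeps the appended part positive.\<close>

lemma sum_compositions_last:
  assumes "0 < n" "0 < m"
  shows "(\<Sum>I | I \<in> compositions n \<and> m \<le> last I. f I)
    = (\<Sum>i=m..n. \<Sum>J\<in>compositions (n - i). f (J @ [i]))"
proof -
  have "(\<Sum>i=m..n. \<Sum>J\<in>compositions (n - i). f (J @ [i]))
      = (\<Sum>(i, J)\<in>(SIGMA i:{m..n}. compositions (n - i)). f (J @ [i]))"
    by (subst sum.Sigma) auto
  also have "\<dots> = (\<Sum>I | I \<in> compositions n \<and> m \<le> last I. f I)"
  proof (rule sum.reindex_bij_witness[where i = "\<lambda>I. (last I, butlast I)" and j = "\<lambda>(i, J). J @ [i]"], goal_cases)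
    case (3 I)
    then have "I \<noteq> []" using assms compositions_nonempty by auto
    then show ?case by simp
  next
    case (4 I)
    then have ne: "I \<noteq> []" using assms compositions_nonempty by auto
    then obtain J i where "I = J @ [i]" by (metis rev_exhaust)
    with 4 show ?case by (auto simp: compositions_def)
  qed (use assms in \<open>auto simp: compositions_def\<close>)
  finally show ?thesis ..
qed

section \<open>Partial sums, gaps and cutting of compositions\<close>

definition psums :: "nat list \<Rightarrow> nat set" where
  "psums I = {sum_list (take j I) | j. j \<le> length I}"

lemma psums_Nil [simp]: "psums [] = {0}"
  by (auto simp: psums_def)

lemma psums_Cons [simp]: "psums (i # I) = insert 0 ((+) i ` psums I)"
proof -
  have "psums (i # I) = (\<lambda>j. sum_list (take j (i # I))) ` {..Suc (length I)}"
    by (auto simp: psums_def)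
  also have "\<dots> = insert 0 ((+) i ` (\<lambda>j. sum_list (take j I)) ` {..length I})"
    by (simp add: atMost_Suc_eq_insert_0 image_image)
  also have "(\<lambda>j. sum_list (take j I)) ` {..length I} = psums I"
    by (auto simp: psums_def)
  finally show ?thesis .
qed

lemma psums_le: "s \<in> psums I \<Longrightarrow> s \<le> sum_list I"
  by (induction I arbitrary: s) auto

lemma zero_in_psums [simp]: "0 \<in> psums I"
  by (cases I) auto

lemma psums_append: "psums (J @ K) = psums J \<union> (+) (sum_list J) ` psums K"
  by (induction J) (auto simp: image_Un image_image add.assoc)

lemma sum_list_in_psums [simp]: "sum_list I \<in> psums I"
  by (induction I) auto

lemma psums_split:
  assumes "a \<in> psums I"
  obtains J K where "I = J @ K" "sum_list J = a"
proof -
  from assms obtain j where "a = sum_list (take j I)" by (auto simp: psums_def)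
  then show thesis using that[of "take j I" "drop j I"] by simp
qed

lemma finite_psums [simp]: "finite (psums I)"
  by (induction I) auto

text \<open>\<open>sigma_comp I t\<close> is the first partial sum from \<open>t\<close> on, so a
  bound on \<open>Theta_comp\<close> says that the partial sums leave a gap. The hypothesis makes
  the set under \<open>Min\<close> nonempty, as it contains the total.\<close>

lemma Theta_comp_ge_iff:
  assumes "t \<le> sum_list I"
  shows "r \<le> Theta_comp I t \<longleftrightarrow> psums I \<inter> {t..<t + r} = {}"
proof -
  let ?M = "{s \<in> psums I. t \<le> s}"
  have M: "sigma_comp I t = Min ?M"
    unfolding sigma_comp_def psums_def by (rule arg_cong[of _ _ Min]) auto
  have ne: "?M \<noteq> {}" using assms sum_list_in_psums[of I] by blast
  have "t \<le> Min ?M" using ne by (subst Min_ge_iff) auto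
  then have "r \<le> Theta_comp I t \<longleftrightarrow> t + r \<le> Min ?M"
    by (auto simp: Theta_comp_def M)
  also have "\<dots> \<longleftrightarrow> (\<forall>s\<in>?M. t + r \<le> s)"
    using ne by (subst Min_ge_iff) auto
  also have "\<dots> \<longleftrightarrow> psums I \<inter> {t..<t + r} = {}"
    by (auto simp: not_less[symmetric])
  finally show ?thesis .
qed

text \<open>Parts are positive, so two prefixes of one list with the same sum coincide: what
  separates them has sum 0 and is empty.\<close>

lemma append_inj_on_compositions:
  "inj_on (\<lambda>(J, K). J @ K) (compositions a \<times> compositions b)"
proof (rule inj_onI, clarify)
  fix J K J' K'
  assume *: "J \<in> compositions a" "J' \<in> compositions a" "J @ K = J' @ K'"
  have empty: "us = []" if "sum_list us = 0" "\<forall>x\<in>set us. 0 < x" for us :: "nat list"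
    using that by (cases us) auto
  from *(3) obtain us where "J = J' @ us \<and> us @ K = K' \<or> J @ us = J' \<and> K = us @ K'"
    unfolding append_eq_append_conv2 by blast
  then show "J = J' \<and> K = K'"
  proof
    assume us: "J = J' @ us \<and> us @ K = K'"
    with * have "us = []" by (intro empty) (simp_all add: compositions_def)
    with us show ?thesis by simp
  next
    assume us: "J @ us = J' \<and> K = us @ K'"
    with * have "us = []" by (intro empty) (auto simp add: compositions_def)
    with us show ?thesis by simp
  qed
qed

text \<open>Cutting at the partial sum \<open>a\<close> is a bijection onto pairs of compositions of
  \<open>a\<close> and \<open>b\<close>; the hypothesis lets the side condition factor along
  it.\<close>

lemma sum_compositions_split:
  assumes "\<And>J K. J \<in> compositions a \<Longrightarrow> K \<in> compositions b \<Longrightarrow> Q (J @ K) \<longleftrightarrow> R J \<and> S K"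
  shows "(\<Sum>I | I \<in> compositions (a + b) \<and> a \<in> psums I \<and> Q I. f I)
    = (\<Sum>J | J \<in> compositions a \<and> R J. \<Sum>K | K \<in> compositions b \<and> S K. f (J @ K))"
proof -
  let ?A = "{J \<in> compositions a. R J}" and ?B = "{K \<in> compositions b. S K}"
  have "{I \<in> compositions (a + b). a \<in> psums I \<and> Q I} = (\<lambda>(J, K). J @ K) ` (?A \<times> ?B)"
  proof (intro equalityI subsetI)
    fix I assume I: "I \<in> {I \<in> compositions (a + b). a \<in> psums I \<and> Q I}"
    then obtain J K where JK: "I = J @ K" "sum_list J = a" by (auto elim: psums_split)
    with I have "J \<in> compositions a" "K \<in> compositions b" by (auto simp: compositions_def)
    with JK I assms show "I \<in> (\<lambda>(J, K). J @ K) ` (?A \<times> ?B)" by auto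
  next
    fix I assume "I \<in> (\<lambda>(J, K). J @ K) ` (?A \<times> ?B)"
    then obtain J K where JK: "I = J @ K" "J \<in> ?A" "K \<in> ?B" by auto
    moreover have "sum_list J \<in> psums I" unfolding JK psums_append by simp
    ultimately show "I \<in> {I \<in> compositions (a + b). a \<in> psums I \<and> Q I}"
      using assms by (auto simp: compositions_def)
  qed
  moreover have "inj_on (\<lambda>(J, K). J @ K) (?A \<times> ?B)"
    by (rule inj_on_subset[OF append_inj_on_compositions[of a b]]) auto
  ultimately show ?thesis
    by (simp add: sum.reindex sum.cartesian_product case_prod_unfold)
qed

text \<open>The least positive partial sum is the first part.\<close>

lemma psums_hd:
  assumes "K \<in> compositions n" "0 < n"
  shows "psums K \<inter> {1..<m} = {} \<longleftrightarrow> m \<le> hd K"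
proof -
  obtain i L where K: "K = i # L" using compositions_nonempty[OF assms] by (cases K) auto
  then have "0 < i" "i \<in> psums K" using assms by (auto simp: compositions_def image_iff intro: bexI[of _ 0])
  moreover have "s = 0 \<or> i \<le> s" if "s \<in> psums K" for s using that unfolding K by auto
  ultimately have "psums K \<inter> {1..<m} = {} \<longleftrightarrow> m \<le> i"
    by (cases "m \<le> i") fastforce+
  then show ?thesis unfolding K by simp
qed

text \<open>The greatest partial sum below the total \<open>h + m\<close> is
  \<open>h + m - last J\<close>, which is at most \<open>h\<close> exactly if \<open>last J\<close>
  is at least \<open>m\<close>.\<close>

lemma psums_last:
  assumes "J \<in> compositions (h + m)" "0 < m"
  shows "psums J \<inter> {h + 1..<h + m} = {} \<longleftrightarrow> m \<le> last J"
proof -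
  obtain L i where J: "J = L @ [i]"
    using compositions_nonempty[OF assms(1)] assms(2) by (metis add_gr_0 rev_exhaust)
  then have i: "0 < i" "sum_list L + i = h + m" using assms by (auto simp: compositions_def)
  have "psums J = psums L \<union> {sum_list L, h + m}" unfolding J psums_append using i by auto
  moreover have "s \<le> sum_list L" if "s \<in> psums L" for s using that by (rule psums_le)
  moreover have "sum_list L \<in> psums L" by simp
  ultimately show ?thesis using i unfolding J by fastforce
qed

section \<open>Weights of extended and concatenated compositions\<close>

lemma w_comp_snoc:
  "0 < i \<Longrightarrow> w_comp (J @ [i]) = (i - 1) * w_comp J + (if J = [] then 1 else 0)"
  by (cases J) auto

lemma w_comp_append: "J \<noteq> [] \<Longrightarrow> w_comp (J @ K) = w_comp J * prod_list (map (\<lambda>x. x - 1) K)"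
  by (cases J) auto

lemma w_comp_rev_snoc: "w_comp (rev (K @ [k])) = k * prod_list (map (\<lambda>x. x - 1) K)"
  by (simp add: rev_map[symmetric] prod_list.rev)

text \<open>In the left-hand weight the first and the last part count fully and all others are
  lowered by one. After a cut, the first part is the leading part of \<open>J\<close> and the last
  part is the leading part of \<open>rev K\<close>.\<close>

lemma last_w_comp_append:
  assumes "J \<noteq> []" "K \<noteq> []"
  shows "last (J @ K) * w_comp (butlast (J @ K)) = w_comp J * w_comp (rev K)"
proof -
  from assms(2) obtain L k where K: "K = L @ [k]" by (metis rev_exhaust)
  have "last (J @ K) * w_comp (butlast (J @ K)) = k * w_comp (J @ L)"
    unfolding K append_assoc[symmetric] by (simp only: last_snoc butlast_snoc)
  also have "\<dots> = w_comp J * w_comp (rev K)"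
    unfolding K w_comp_append[OF assms(1)] w_comp_rev_snoc by (simp only: mult_ac)
  finally show ?thesis .
qed

lemma last_w_comp_Cons: "last (i # K) * w_comp (butlast (i # K)) = i * w_comp (rev K)"
proof (cases K rule: rev_cases)
  case (snoc L k)
  then show ?thesis by (simp add: rev_map[symmetric] prod_list.rev)
qed simp

section \<open>Expansions in the elementary basis\<close>

context color_weights
begin

definition ecomp :: "nat list \<Rightarrow> 'a" where
  "ecomp I = prod_list (map (esym C) I)"

lemma ecomp_simps [simp]:
  "ecomp [] = 1" "ecomp (i # I) = esym C i * ecomp I" "ecomp (I @ J) = ecomp I * ecomp J"
  "ecomp (rev I) = ecomp I"
  by (simp_all add: ecomp_def rev_map[symmetric] prod_list.rev)

text \<open>Sorting by the last part \<open>i\<close> turns the sum into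
  \<open>lolli_expand\<close>: removing \<open>i\<close> leaves the factor \<open>i - 1\<close>,
  except that the one-part composition contributes one more \<open>esym C n\<close>. The path
  expansion is assumed only below \<open>n\<close>, so that the lemma can also drive the induction
  proving it.\<close>

lemma lolli_compositions_aux:
  assumes "\<And>k. k < n \<Longrightarrow> (\<Sum>I\<in>compositions k. of_nat (w_comp I) * ecomp I) = pathp k"
    and "0 < m" "m \<le> n"
  shows "(\<Sum>I | I \<in> compositions n \<and> m \<le> last I. of_nat (w_comp I) * ecomp I) = lolli (n - m) (m - 1)"
proof -
  have "(\<Sum>J\<in>compositions (n - i). of_nat (w_comp (J @ [i])) * ecomp (J @ [i]))
      = of_nat (i - 1) * esym C i * pathp (n - i) + (if i = n then esym C n else 0)"
    if i: "i \<in> {m..n}" for i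
  proof -
    have "(\<Sum>J\<in>compositions (n - i). of_nat (w_comp (J @ [i])) * ecomp (J @ [i]))
        = (\<Sum>J\<in>compositions (n - i). of_nat (i - 1) * esym C i * (of_nat (w_comp J) * ecomp J)
            + (if J = [] then esym C i else 0))"
      using i assms(2) by (intro sum.cong refl) (auto simp: w_comp_snoc algebra_simps)
    also have "\<dots> = of_nat (i - 1) * esym C i * pathp (n - i)
        + (\<Sum>J\<in>compositions (n - i). if J = [] then esym C i else 0)"
      using i assms by (simp add: sum.distrib sum_distrib_left[symmetric])
    also have "(\<Sum>J\<in>compositions (n - i). if J = [] then esym C i else 0) = (if i = n then esym C n else 0)"
      using i by auto
    finally show ?thesis .
  qed
  then have "(\<Sum>I | I \<in> compositions n \<and> m \<le> last I. of_nat (w_comp I) * ecomp I)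
      = (\<Sum>i=m..n. of_nat (i - 1) * esym C i * pathp (n - i) + (if i = n then esym C n else 0))"
    using assms by (simp add: sum_compositions_last)
  also have "\<dots> = (\<Sum>i=m..n. of_nat (i - 1) * esym C i * pathp (n - i)) + esym C n"
    using assms by (simp add: sum.distrib)
  also have "\<dots> = lolli (n - m) (m - 1)"
    using assms by (simp add: lolli_expand add.commute)
  finally show ?thesis .
qed

text \<open>The case \<open>m = 1\<close> of the previous lemma: a last part of at least 1 is no
  restriction, and \<open>lolli (n - 1) 0\<close> is the path on \<open>n\<close> vertices.\<close>

lemma pathp_compositions: "(\<Sum>I\<in>compositions n. of_nat (w_comp I) * ecomp I) = pathp n"
proof (induction n rule: less_induct)
  case (less n)
  show ?case
  proof (cases "n = 0")
    case False
    have "{I. I \<in> compositions n \<and> 1 \<le> last I} = compositions n"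
      using False compositions_nonempty[of _ n] by (auto simp: compositions_def Suc_le_eq)
    then show ?thesis
      using lolli_compositions_aux[of n 1] less False by (simp add: lolli_k0)
  qed simp
qed

lemmas lolli_compositions = lolli_compositions_aux[OF pathp_compositions]

lemma pathp_compositions_rev: "(\<Sum>I\<in>compositions n. of_nat (w_comp (rev I)) * ecomp I) = pathp n"
  using sum_compositions_rev[of "\<lambda>I. of_nat (w_comp I) * ecomp I" n "\<lambda>_. True"]
  by (simp add: pathp_compositions)

text \<open>For \<open>h < n\<close> and \<open>0 < m\<close>, \<open>Theta_comp_ge_iff\<close>
  identifies this with the sum over \<open>Theta_comp I (h + 1) \<ge> m - 1\<close> in the theorem,
  without the factor \<open>m - 2\<close>.\<close>

definition gapsum :: "nat \<Rightarrow> nat \<Rightarrow> nat \<Rightarrow> 'a" where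
  "gapsum n h m = (\<Sum>I | I \<in> compositions n \<and> psums I \<inter> {h + 1..<h + m} = {}.
     of_nat (last I * w_comp (butlast I)) * ecomp I)"

text \<open>For \<open>h = 0\<close> the gap condition bounds the first part from below. Reversal
  moves it to the end, where it splits off with full weight \<open>i\<close> and leaves
  \<open>w_comp J\<close>.\<close>

lemma gapsum_0:
  assumes "0 < m" "m \<le> n"
  shows "gapsum n 0 m = (\<Sum>i=m..n. of_nat i * esym C i * pathp (n - i))"
proof -
  define F where "F I = of_nat (last I * w_comp (butlast I)) * ecomp I" for I
  have "last (rev (J @ [i])) * w_comp (butlast (rev (J @ [i]))) = i * w_comp J" for i J
    using last_w_comp_Cons[of i "rev J"] by simp
  then have f: "F (rev (J @ [i])) = of_nat i * esym C i * (of_nat (w_comp J) * ecomp J)" for i J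
    
    by (simp only: F_def ecomp_simps of_nat_mult) (simp add: mult_ac)
  have "gapsum n 0 m = (\<Sum>I | I \<in> compositions n \<and> m \<le> hd I. F I)"
    using assms psums_hd[of _ n m] unfolding gapsum_def F_def by (intro sum.cong) auto
  also have "\<dots> = (\<Sum>I | I \<in> compositions n \<and> m \<le> hd (rev I). F (rev I))"
    by (rule sum_compositions_rev[symmetric])
  also have "\<dots> = (\<Sum>i=m..n. \<Sum>J\<in>compositions (n - i). F (rev (J @ [i])))"
    using assms by (simp add: hd_rev sum_compositions_last)
  also have "\<dots> = (\<Sum>i=m..n. of_nat i * esym C i * pathp (n - i))"
    unfolding f by (simp add: sum_distrib_left[symmetric] pathp_compositions)
  finally show ?thesis .
qed

text \<open>Both gap conditions share the compositions without partial sum in \<open>{h+1..h+m}\<close>; the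
  remaining ones have the partial sum \<open>h + m\<close> or \<open>h + 1\<close>, at which they are cut in two.\<close>

lemma gapsum_shift:
  assumes "0 < m" and n: "n = Suc g + h + m"
  shows "gapsum n (Suc h) m + pathp (Suc g) * lolli h (m - 1)
    = gapsum n h m + pathp (Suc h) * lolli g (m - 1)"
proof -
  let ?f = "\<lambda>I. of_nat (last I * w_comp (butlast I)) * ecomp I"
  let ?c = "\<lambda>P. \<Sum>I | I \<in> compositions n \<and> P I. ?f I"
  let ?mid = "\<lambda>I. psums I \<inter> {h + 1..<h + Suc m} = {}"
  have cut: "?f (J @ K) = of_nat (w_comp J) * ecomp J * (of_nat (w_comp (rev K)) * ecomp K)"
    if "J \<in> compositions a" "K \<in> compositions b" "0 < a" "0 < b" for J K a b
    
    by (simp only: last_w_comp_append[OF compositions_nonempty[OF that(1,3)] compositions_nonempty[OF that(2,4)]]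
        of_nat_mult ecomp_simps mult_ac)
  have split: "?c P = ?c (\<lambda>I. P I \<and> \<not> Q I) + ?c (\<lambda>I. Q I \<and> P I)" for P Q
    by (subst sum.Int_Diff[where B = "{I. \<not> Q I}"], simp)
       (intro arg_cong2[of _ _ _ _ "(+)"] sum.cong; auto)

  have 1: "gapsum n h m = ?c ?mid + ?c (\<lambda>I. h + m \<in> psums I \<and> psums I \<inter> {h + 1..<h + m} = {})"
  proof -
    have "(psums I \<inter> {h + 1..<h + m} = {} \<and> h + m \<notin> psums I) = ?mid I" for I
    proof -
      have "{h + 1..<h + Suc m} = insert (h + m) {h + 1..<h + m}" using assms(1) by auto
      then show ?thesis by auto
    qed
    then show ?thesis
      unfolding gapsum_def using split[of "\<lambda>I. psums I \<inter> {h + 1..<h + m} = {}" "\<lambda>I. h + m \<in> psums I"]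
      by (simp only:)
  qed
  have 2: "gapsum n (Suc h) m = ?c ?mid + ?c (\<lambda>I. h + 1 \<in> psums I \<and> psums I \<inter> {Suc h + 1..<Suc h + m} = {})"
  proof -
    have "{h + 1..<h + Suc m} = insert (h + 1) {Suc h + 1..<Suc h + m}"
      using assms(1) by auto
    then have "(psums I \<inter> {Suc h + 1..<Suc h + m} = {} \<and> h + 1 \<notin> psums I) = ?mid I" for I
      by auto
    then show ?thesis
      unfolding gapsum_def using split[of "\<lambda>I. psums I \<inter> {Suc h + 1..<Suc h + m} = {}" "\<lambda>I. h + 1 \<in> psums I"]
      by (simp only:)
  qed
  have "?c (\<lambda>I. h + m \<in> psums I \<and> psums I \<inter> {h + 1..<h + m} = {})
      = (\<Sum>J | J \<in> compositions (h + m) \<and> m \<le> last J. \<Sum>K\<in>compositions (Suc g). ?f (J @ K))"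
  proof -
    have "psums (J @ K) \<inter> {h + 1..<h + m} = {} \<longleftrightarrow> m \<le> last J \<and> True"
      if "J \<in> compositions (h + m)" for J K
    proof -
      have "sum_list J = h + m" using that by (simp add: compositions_def)
      then have "psums (J @ K) \<inter> {h + 1..<h + m} = psums J \<inter> {h + 1..<h + m}"
        unfolding psums_append by auto
      then show ?thesis using psums_last[OF that assms(1)] by simp
    qed
    from sum_compositions_split[of "h + m" "Suc g" "\<lambda>I. psums I \<inter> {h + 1..<h + m} = {}"
        "\<lambda>J. m \<le> last J" "\<lambda>_. True" ?f, OF this] show ?thesis
      by (simp add: n add_ac)
  qed
  \<comment> \<open>By \<open>cut\<close> the second piece carries the weight of its reversal, so
    the path expansion enters in its reversed form.\<close>
  also have "\<dots> = (\<Sum>J | J \<in> compositions (h + m) \<and> m \<le> last J. of_nat (w_comp J) * ecomp J) * pathp (Suc g)"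
    unfolding pathp_compositions_rev[symmetric] sum_product
    by (intro sum.cong refl cut[where a = "h + m" and b = "Suc g"]) (use assms(1) in auto)
  also have "\<dots> = lolli h (m - 1) * pathp (Suc g)"
    using assms by (simp add: lolli_compositions)
  finally have 3: "?c (\<lambda>I. h + m \<in> psums I \<and> psums I \<inter> {h + 1..<h + m} = {}) = lolli h (m - 1) * pathp (Suc g)" .
  have "?c (\<lambda>I. h + 1 \<in> psums I \<and> psums I \<inter> {Suc h + 1..<Suc h + m} = {})
      = (\<Sum>J\<in>compositions (Suc h). \<Sum>K | K \<in> compositions (g + m) \<and> m \<le> hd K. ?f (J @ K))"
  proof -
    have "psums (J @ K) \<inter> {Suc h + 1..<Suc h + m} = {} \<longleftrightarrow> True \<and> m \<le> hd K"
      if "J \<in> compositions (h + 1)" "K \<in> compositions (g + m)" for J K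
    proof -
      have J: "sum_list J = Suc h" using that by (simp add: compositions_def)
      then have "psums (J @ K) \<inter> {Suc h + 1..<Suc h + m} = (+) (Suc h) ` (psums K \<inter> {1..<m})"
        unfolding psums_append by (auto dest: psums_le)
      then show ?thesis using psums_hd[OF that(2), of m] assms(1) by simp
    qed
    from sum_compositions_split[of "h + 1" "g + m" "\<lambda>I. psums I \<inter> {Suc h + 1..<Suc h + m} = {}"
        "\<lambda>_. True" "\<lambda>K. m \<le> hd K" ?f, OF this] show ?thesis
      by (simp add: n add_ac)
  qed
  also have "\<dots> = pathp (Suc h) * (\<Sum>K | K \<in> compositions (g + m) \<and> m \<le> hd K. of_nat (w_comp (rev K)) * ecomp K)"
    unfolding pathp_compositions[symmetric] sum_product
    by (intro sum.cong refl cut[where a = "Suc h" and b = "g + m"]) (use assms(1) in auto)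
  \<comment> \<open>Reversal mends both the weight and the condition, which moves from the first
    part to the last.\<close>
  also have "(\<Sum>K | K \<in> compositions (g + m) \<and> m \<le> hd K. of_nat (w_comp (rev K)) * ecomp K)
      = (\<Sum>K | K \<in> compositions (g + m) \<and> m \<le> last K. of_nat (w_comp K) * ecomp K)"
    using sum_compositions_rev[of "\<lambda>I. of_nat (w_comp I) * ecomp I" "g + m" "\<lambda>I. m \<le> last I"]
    by (simp add: last_rev)
  also have "\<dots> = lolli g (m - 1)"
    using assms by (simp add: lolli_compositions)
  finally have 4: "?c (\<lambda>I. h + 1 \<in> psums I \<and> psums I \<inter> {Suc h + 1..<Suc h + m} = {}) = pathp (Suc h) * lolli g (m - 1)" .
  show ?thesis
    unfolding 1 2 3 4 by (simp add: algebra_simps)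
qed

text \<open>Induction on \<open>h\<close> with \<open>g + h\<close> fixed: the first and the third
  summand do not depend on \<open>h\<close>, and \<open>pcp_shift\<close> matches
  \<open>gapsum_shift\<close> multiplied by \<open>k\<close>. In the base case the graph is a
  lollipop.\<close>

lemma pcp_gapsum:
  assumes "n = g + h + Suc (Suc k)"
  shows "pcp g h k = of_nat (Suc k) * esym C n + of_nat k * gapsum n h (Suc (Suc k))
    + (\<Sum>I | I \<in> compositions n \<and> Suc k \<le> last I. of_nat (last I - Suc k) * of_nat (w_comp (butlast I)) * ecomp I)"
  using assms
proof (induction h arbitrary: g)
  case 0
  let ?m = "Suc (Suc k)"
  have "(\<Sum>I | I \<in> compositions n \<and> Suc k \<le> last I. of_nat (last I - Suc k) * of_nat (w_comp (butlast I)) * ecomp I)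
      = (\<Sum>i=Suc k..n. of_nat (i - Suc k) * esym C i * pathp (n - i))"
    using 0 by (subst sum_compositions_last)
      (simp_all add: pathp_compositions[symmetric] sum_distrib_left mult_ac)
  \<comment> \<open>The term \<open>i = Suc k\<close> has coefficient 0, so all sums now start at
    \<open>?m\<close>.\<close>
  also have "\<dots> = (\<Sum>i=?m..n. of_nat (i - Suc k) * esym C i * pathp (n - i))"
    using 0 by (subst sum.atLeast_Suc_atMost) simp_all
  finally have S: "(\<Sum>I | I \<in> compositions n \<and> Suc k \<le> last I. of_nat (last I - Suc k) * of_nat (w_comp (butlast I)) * ecomp I)
      = (\<Sum>i=?m..n. of_nat (i - Suc k) * esym C i * pathp (n - i))" .
  have T: "gapsum n 0 ?m = (\<Sum>i=?m..n. of_nat i * esym C i * pathp (n - i))"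
    using 0 by (intro gapsum_0) simp_all
  \<comment> \<open>This splits each lollipop coefficient between the gap sum and the sum over large
    last parts.\<close>
  have coeff: "of_nat (Suc k) * of_nat (i - 1) = (of_nat k * of_nat i + of_nat (i - Suc k) :: 'a)"
    if "i \<in> {?m..n}" for i
  proof -
    have "Suc k * (i - 1) = k * i + (i - Suc k)"
      using that by (cases i) (auto simp: algebra_simps)
    then show ?thesis by (metis of_nat_add of_nat_mult)
  qed
  have "pcp g 0 k = of_nat (Suc k) * lolli g (Suc k)"
    by (subst pcp_commute) (rule pcp_0)
  also have "\<dots> = of_nat (Suc k) * esym C n
      + (\<Sum>i=?m..n. (of_nat (Suc k) * of_nat (i - 1)) * esym C i * pathp (n - i))"
    using 0 by (simp add: lolli_expand distrib_left sum_distrib_left mult_ac del: of_nat_Suc)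
  also have "(\<Sum>i=?m..n. (of_nat (Suc k) * of_nat (i - 1)) * esym C i * pathp (n - i))
      = (\<Sum>i=?m..n. (of_nat k * of_nat i + of_nat (i - Suc k)) * esym C i * pathp (n - i))"
    by (intro sum.cong refl) (simp only: coeff)
  also have "\<dots> = of_nat k * (\<Sum>i=?m..n. of_nat i * esym C i * pathp (n - i))
      + (\<Sum>i=?m..n. of_nat (i - Suc k) * esym C i * pathp (n - i))"
    by (simp only: distrib_right sum.distrib sum_distrib_left mult.assoc)
  finally show ?case
    unfolding S T by (simp only: add.assoc)
next
  case (Suc h)
  have n: "n = Suc g + h + Suc (Suc k)" using Suc.prems by simp
  have pcp: "pcp g (Suc h) k = pcp (Suc g) h k
      - of_nat k * (pathp (Suc g) * lolli h (Suc k) - pathp (Suc h) * lolli g (Suc k))"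
    by (simp add: pcp_shift)
  have gap: "gapsum n (Suc h) (Suc (Suc k)) = gapsum n h (Suc (Suc k)) + pathp (Suc h) * lolli g (Suc k)
      - pathp (Suc g) * lolli h (Suc k)"
    using gapsum_shift[of "Suc (Suc k)" n g h] n by (simp add: algebra_simps)
  show ?case
    unfolding pcp gap Suc.IH[OF n] by (simp add: algebra_simps del: of_nat_diff)
qed

end

section \<open>Colourings as lists\<close>

text \<open>A colouring is the list of colours of the vertices 0, 1, and so on. The three segments
  are the first path, the clique and the second path; they overlap in \<open>u = g\<close> and
  \<open>v = g + m - 1\<close>.\<close>

lemma pcp_proper_iff:
  assumes n: "length l = g + h + m" and m: "2 \<le> m"
  shows "(\<forall>i<g + h + m. \<forall>j<g + h + m. pcp_edge g h m i j \<longrightarrow> l ! i \<noteq> l ! j) \<longleftrightarrow>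
    distinct_adj (take (g + 1) l) \<and> distinct (take m (drop g l)) \<and> distinct_adj (drop (g + m - 1) l)"
    (is "?P \<longleftrightarrow> ?Q")
proof
  assume P: ?P
  have "l ! i \<noteq> l ! Suc i" if "Suc i < g + 1" for i
    using that P[rule_format, of i "Suc i"] m by (auto simp: pcp_edge_def)
  moreover have "l ! (g + i) \<noteq> l ! (g + j)" if "i < m" "j < m" "i \<noteq> j" for i j
    using that P[rule_format, of "g + i" "g + j"] m by (auto simp: pcp_edge_def)
  moreover have "l ! (g + m - 1 + i) \<noteq> l ! (g + m - 1 + Suc i)" if "Suc i < length (drop (g + m - 1) l)" for i
  proof -
    have "pcp_edge g h m (g + m - 1 + i) (g + m - 1 + Suc i)"
      using that m n by (auto simp: pcp_edge_def)
    moreover from this have "g + m - 1 + i < g + h + m" "g + m - 1 + Suc i < g + h + m"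
      by (simp_all add: pcp_edge_def)
    ultimately show ?thesis using P by blast
  qed
  ultimately show ?Q
    using n by (simp add: distinct_adj_conv_nth distinct_conv_nth)
next
  assume Q: ?Q
  have 1: "l ! i \<noteq> l ! Suc i" if "i < g" for i
    using that Q n m by (auto simp: distinct_adj_conv_nth)
  have 2: "l ! i \<noteq> l ! j" if "g \<le> i" "g \<le> j" "i < g + m" "j < g + m" "i \<noteq> j" for i j
  proof -
    have "take m (drop g l) ! (i - g) \<noteq> take m (drop g l) ! (j - g)"
      using that Q n by (subst nth_eq_iff_index_eq) auto
    then show ?thesis using that n by simp
  qed
  have 3: "l ! i \<noteq> l ! Suc i" if "g + m - 1 \<le> i" "Suc i < g + h + m" for i
  proof -
    have "drop (g + m - 1) l ! (i - (g + m - 1)) \<noteq> drop (g + m - 1) l ! Suc (i - (g + m - 1))"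
      using that Q n by (intro distinct_adj_nth) auto
    then show ?thesis using that n by simp
  qed
  show ?P
  proof (intro allI impI)
    fix i j assume "i < g + h + m" "j < g + h + m" "pcp_edge g h m i j"
    then consider "i < g" "j = Suc i" | "g + m - 1 \<le> i" "j = Suc i" "j < g + h + m"
      | "j < g" "i = Suc j" | "g + m - 1 \<le> j" "i = Suc j" "i < g + h + m"
      | "g \<le> i" "g \<le> j" "i < g + m" "j < g + m" "i \<noteq> j"
      by (auto simp: pcp_edge_def)
    then show "l ! i \<noteq> l ! j"
      using 1 2 3 by cases metis+
  qed
qed

context color_weights
begin

text \<open>The starting colour \<open>a\<close> stays outside the list, because the path shares its
  first vertex with the clique.\<close>

definition walks :: "nat \<Rightarrow> 'c \<Rightarrow> 'c list set" where
  "walks k a = {A. length A = k \<and> set A \<subseteq> C \<and> distinct_adj (a # A)}"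

definition arrangements :: "nat \<Rightarrow> 'c set \<Rightarrow> 'c list set" where
  "arrangements k A = {M. length M = k \<and> set M \<subseteq> A \<and> distinct M}"

lemma finite_walks [simp]: "finite (walks k a)"
  by (rule finite_subset[OF _ finite_lists_length_eq[OF finC, of k]]) (auto simp: walks_def)

lemma finite_arrangements [simp]: "finite A \<Longrightarrow> finite (arrangements k A)"
  by (rule finite_subset[OF _ finite_lists_length_eq[of A k]]) (auto simp: arrangements_def)

lemma sum_walks: "x a * (\<Sum>A\<in>walks k a. prod_list (map x A)) = walk k a"
proof (induction k arbitrary: a)
  case 0
  have "walks 0 a = {[]}" by (auto simp: walks_def)
  then show ?case by simp
next
  case (Suc k)
  have "walks (Suc k) a = (\<lambda>(d, L). d # L) ` (SIGMA d:C - {a}. walks k d)"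
  proof (intro equalityI subsetI)
    fix N assume N: "N \<in> walks (Suc k) a"
    then obtain d L where "N = d # L" by (cases N) (auto simp: walks_def)
    with N show "N \<in> (\<lambda>(d, L). d # L) ` (SIGMA d:C - {a}. walks k d)" by (auto simp: walks_def)
  qed (auto simp: walks_def)
  moreover have "inj_on (\<lambda>(d, L). d # L) (SIGMA d:C - {a}. walks k d)" by (auto simp: inj_on_def)
  ultimately have "(\<Sum>A\<in>walks (Suc k) a. prod_list (map x A))
      = (\<Sum>(d, A)\<in>(SIGMA d:C - {a}. walks k d). x d * prod_list (map x A))"
    by (simp add: sum.reindex case_prod_unfold)
  also have "\<dots> = (\<Sum>d\<in>C - {a}. x d * (\<Sum>A\<in>walks k d. prod_list (map x A)))"
    using finC by (subst sum.Sigma[symmetric]) (auto simp: sum_distrib_left)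
  finally show ?case by (simp add: Suc.IH)
qed

text \<open>Each \<open>k\<close>-subset has \<open>k!\<close> orderings; for the inner clique
  vertices this is the origin of \<open>(m - 2)!\<close>. The induction removes the first entry and
  uses \<open>sum_esym_remove\<close>.\<close>

lemma sum_arrangements:
  "finite A \<Longrightarrow> (\<Sum>M\<in>arrangements k A. prod_list (map x M)) = of_nat (fact k) * esym A k"
proof (induction k arbitrary: A)
  case 0
  have "arrangements 0 A = {[]}" by (auto simp: arrangements_def)
  then show ?case using 0 by simp
next
  case (Suc k)
  have "arrangements (Suc k) A = (\<lambda>(d, L). d # L) ` (SIGMA d:A. arrangements k (A - {d}))"
  proof (intro equalityI subsetI)
    fix N assume N: "N \<in> arrangements (Suc k) A"
    then obtain d L where "N = d # L" by (cases N) (auto simp: arrangements_def)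
    with N show "N \<in> (\<lambda>(d, L). d # L) ` (SIGMA d:A. arrangements k (A - {d}))" by (auto simp: arrangements_def)
  qed (auto simp: arrangements_def)
  moreover have "inj_on (\<lambda>(d, L). d # L) (SIGMA d:A. arrangements k (A - {d}))" by (auto simp: inj_on_def)
  ultimately have "(\<Sum>M\<in>arrangements (Suc k) A. prod_list (map x M))
      = (\<Sum>(d, M)\<in>(SIGMA d:A. arrangements k (A - {d})). x d * prod_list (map x M))"
    by (simp add: sum.reindex case_prod_unfold)
  also have "\<dots> = (\<Sum>d\<in>A. x d * (\<Sum>M\<in>arrangements k (A - {d}). prod_list (map x M)))"
    using Suc.prems by (subst sum.Sigma[symmetric]) (auto simp: sum_distrib_left)
  also have "\<dots> = of_nat (fact k) * (\<Sum>d\<in>A. x d * esym (A - {d}) k)"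
    using Suc by (simp add: sum_distrib_left mult_ac)
  finally show ?case
    using Suc.prems by (simp add: sum_esym_remove algebra_simps)
qed

definition pcp_colorings :: "nat \<Rightarrow> nat \<Rightarrow> nat \<Rightarrow> 'c list set" where
  "pcp_colorings g h m = {l. length l = g + h + m \<and> set l \<subseteq> C \<and>
     (\<forall>i<g + h + m. \<forall>j<g + h + m. pcp_edge g h m i j \<longrightarrow> l ! i \<noteq> l ! j)}"

text \<open>Walks are read away from the clique, whereas the first path is listed towards it; hence
  \<open>rev A\<close>.\<close>

lemma mem_pcp_colorings:
  assumes "length A = g" "length B = h" "length M = k"
  shows "rev A @ a # M @ b # B \<in> pcp_colorings g h (k + 2) \<longleftrightarrow>
    a \<in> C \<and> b \<in> C - {a} \<and> A \<in> walks g a \<and> B \<in> walks h b \<and> M \<in> arrangements k (C - {a, b})"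
proof -
  let ?l = "rev A @ a # M @ b # B"
  have len: "length ?l = g + h + (k + 2)" using assms by simp
  have 1: "take (g + 1) ?l = rev (a # A)" using assms by simp
  have 2: "take (k + 2) (drop g ?l) = a # M @ [b]" using assms by simp
  have 3: "drop (g + (k + 2) - 1) ?l = b # B" using assms by simp
  have "(\<forall>i<g + h + (k + 2). \<forall>j<g + h + (k + 2). pcp_edge g h (k + 2) i j \<longrightarrow> ?l ! i \<noteq> ?l ! j)
      \<longleftrightarrow> distinct_adj (a # A) \<and> distinct (a # M @ [b]) \<and> distinct_adj (b # B)"
    using pcp_proper_iff[OF len] unfolding 1 2 3 distinct_adj_rev by simp
  then show ?thesis
    using assms len unfolding pcp_colorings_def walks_def arrangements_def by auto
qed

text \<open>Positions \<open>g\<close> and \<open>g + k + 1\<close> hold the colours of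
  \<open>u\<close> and \<open>v\<close>; cutting there decomposes a colouring uniquely into two
  walks and an arrangement.\<close>

lemma sum_pcp_colorings:
  "(\<Sum>l\<in>pcp_colorings g h (k + 2). prod_list (map x l)) = of_nat (fact k) * pcp g h k"
proof -
  let ?p = "\<lambda>l. prod_list (map x l)"
  let ?Z = "SIGMA a:C. SIGMA b:C - {a}. walks g a \<times> walks h b \<times> arrangements k (C - {a, b})"
  have "(\<Sum>l\<in>pcp_colorings g h (k + 2). ?p l)
      = (\<Sum>(a, b, A, B, M)\<in>?Z. x a * ?p A * (x b * ?p B) * ?p M)"
  proof (rule sum.reindex_bij_witness[where i = "\<lambda>(a, b, A, B, M). rev A @ a # M @ b # B"
        and j = "\<lambda>l. (l ! g, l ! (g + k + 1), rev (take g l), drop (g + k + 2) l, take k (drop (g + 1) l))"])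
    fix l assume l: "l \<in> pcp_colorings g h (k + 2)"
    then have len: "length l = g + h + (k + 2)" by (simp add: pcp_colorings_def)
    define A B M a b where defs: "A = rev (take g l)" "B = drop (g + k + 2) l" "M = take k (drop (g + 1) l)"
      "a = l ! g" "b = l ! (g + k + 1)"
    have "l = take g l @ a # drop (Suc g) l"
      unfolding defs by (rule id_take_nth_drop) (simp add: len)
    moreover have "drop (Suc g) l = M @ b # drop (Suc k) (drop (Suc g) l)"
      using id_take_nth_drop[of k "drop (Suc g) l"] len unfolding defs by simp
    ultimately have split: "rev A @ a # M @ b # B = l"
      unfolding defs by (simp add: add.commute)
    have lens: "length A = g" "length B = h" "length M = k" unfolding defs using len by auto
    have "(a, b, A, B, M) \<in> ?Z"
      using l mem_pcp_colorings[OF lens, of a b] unfolding split by auto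
    then show "(l ! g, l ! (g + k + 1), rev (take g l), drop (g + k + 2) l, take k (drop (g + 1) l)) \<in> ?Z"
      unfolding defs .
    show "(case (l ! g, l ! (g + k + 1), rev (take g l), drop (g + k + 2) l, take k (drop (g + 1) l))
        of (a, b, A, B, M) \<Rightarrow> rev A @ a # M @ b # B) = l"
      using split unfolding defs by simp
    have "x a * ?p A * (x b * ?p B) * ?p M = ?p l"
      unfolding split[symmetric] by (simp add: rev_map[symmetric] prod_list.rev mult_ac)
    then show "(case (l ! g, l ! (g + k + 1), rev (take g l), drop (g + k + 2) l, take k (drop (g + 1) l))
        of (a, b, A, B, M) \<Rightarrow> x a * ?p A * (x b * ?p B) * ?p M) = ?p l"
      unfolding defs by simp
  next
    fix z assume z: "z \<in> ?Z"
    obtain a b A B M where zz: "z = (a, b, A, B, M)" by (metis prod_cases5)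
    have lens: "length A = g" "length B = h" "length M = k"
      using z unfolding zz walks_def arrangements_def by auto
    show "(case z of (a, b, A, B, M) \<Rightarrow> rev A @ a # M @ b # B) \<in> pcp_colorings g h (k + 2)"
      using z mem_pcp_colorings[OF lens, of a b] unfolding zz by auto
    show "(\<lambda>l. (l ! g, l ! (g + k + 1), rev (take g l), drop (g + k + 2) l, take k (drop (g + 1) l)))
        (case z of (a, b, A, B, M) \<Rightarrow> rev A @ a # M @ b # B) = z"
      using lens unfolding zz by (simp add: nth_append)
  qed
  also have "\<dots> = (\<Sum>a\<in>C. \<Sum>b\<in>C - {a}. \<Sum>A\<in>walks g a. \<Sum>B\<in>walks h b. \<Sum>M\<in>arrangements k (C - {a, b}).
      x a * ?p A * (x b * ?p B) * ?p M)"
    using finC by (simp add: sum.Sigma)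
  also have "\<dots> = (\<Sum>a\<in>C. \<Sum>b\<in>C - {a}. (x a * (\<Sum>A\<in>walks g a. ?p A)) * (x b * (\<Sum>B\<in>walks h b. ?p B))
      * (\<Sum>M\<in>arrangements k (C - {a, b}). ?p M))"
    by (simp only: sum_distrib_left[symmetric] sum_distrib_right[symmetric])
  also have "\<dots> = of_nat (fact k) * pcp g h k"
    unfolding sum_walks using finC by (simp add: sum_arrangements pcp_def sum_distrib_left mult_ac)
  finally show ?thesis .
qed

end

section \<open>Extraction of coefficients\<close>

text \<open>Both summands are bounded pointwise by \<alpha>, so they vanish off its finite support.
  Over an infinite set the sum in \<open>sf_mult\<close> would default to 0.\<close>

lemma finite_add_decomp: "finite {(\<beta>, \<gamma>). \<beta> + \<gamma> = (\<alpha> :: nat \<Rightarrow>\<^sub>0 nat)}"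
proof -
  let ?B = "{\<beta>. \<forall>i. Poly_Mapping.lookup \<beta> i \<le> Poly_Mapping.lookup \<alpha> i}"
  let ?b = "Max (Poly_Mapping.lookup \<alpha> ` Poly_Mapping.keys \<alpha>)"
  let ?F = "{f. \<forall>i. (i \<in> Poly_Mapping.keys \<alpha> \<longrightarrow> f i \<in> {..?b}) \<and> (i \<notin> Poly_Mapping.keys \<alpha> \<longrightarrow> f i = 0)}"
  have "Poly_Mapping.lookup ` ?B \<subseteq> ?F"
  proof clarify
    fix \<beta> i assume le: "\<forall>i. Poly_Mapping.lookup \<beta> i \<le> Poly_Mapping.lookup \<alpha> i"
    have "Poly_Mapping.lookup \<beta> i \<le> ?b" if "i \<in> Poly_Mapping.keys \<alpha>"
      by (rule order_trans[OF le[rule_format]]) (use that in simp)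
    with le[rule_format, of i] show "(i \<in> Poly_Mapping.keys \<alpha> \<longrightarrow> Poly_Mapping.lookup \<beta> i \<in> {..?b}) \<and> (i \<notin> Poly_Mapping.keys \<alpha> \<longrightarrow> Poly_Mapping.lookup \<beta> i = 0)"
      by (auto simp: in_keys_iff)
  qed
  moreover have "finite ?F" by (rule finite_set_of_finite_funs) auto
  ultimately have "finite (Poly_Mapping.lookup ` ?B)" by (rule finite_subset)
  then have "finite ?B"
    by (rule finite_imageD) (meson inj_onI poly_mapping_eq_iff)
  then have "finite (?B \<times> ?B)" by simp
  moreover have "{(\<beta>, \<gamma>). \<beta> + \<gamma> = \<alpha>} \<subseteq> ?B \<times> ?B" by (auto simp: lookup_add)
  ultimately show ?thesis by (rule rev_finite_subset)
qed

text \<open>This matches the product of polynomials with the convolution in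
  \<open>sf_mult\<close>.\<close>

lemma lookup_times_sum:
  fixes f g :: "(nat \<Rightarrow>\<^sub>0 nat) \<Rightarrow>\<^sub>0 'a :: semiring_0"
  shows "Poly_Mapping.lookup (f * g) \<alpha> = (\<Sum>(\<beta>, \<gamma>)\<in>{(\<beta>, \<gamma>). \<beta> + \<gamma> = \<alpha>}. Poly_Mapping.lookup f \<beta> * Poly_Mapping.lookup g \<gamma>)"
proof -
  have "Poly_Mapping.lookup (f * g) \<alpha> = (\<Sum>(\<beta>, \<gamma>). Poly_Mapping.lookup f \<beta> * Poly_Mapping.lookup g \<gamma> when \<alpha> = \<beta> + \<gamma>)"
    by (simp add: times_poly_mapping.rep_eq prod_fun_unfold_prod)
  also have "\<dots> = (\<Sum>(\<beta>, \<gamma>)\<in>{(\<beta>, \<gamma>). \<beta> + \<gamma> = \<alpha>}. Poly_Mapping.lookup f \<beta> * Poly_Mapping.lookup g \<gamma> when \<alpha> = \<beta> + \<gamma>)"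
    by (rule Sum_any.expand_superset) (auto simp: finite_add_decomp when_def split: if_splits)
  also have "\<dots> = (\<Sum>(\<beta>, \<gamma>)\<in>{(\<beta>, \<gamma>). \<beta> + \<gamma> = \<alpha>}. Poly_Mapping.lookup f \<beta> * Poly_Mapping.lookup g \<gamma>)"
    by (rule sum.cong) (auto simp: when_def)
  finally show ?thesis .
qed

lemma lookup_of_nat_times:
  "Poly_Mapping.lookup (of_nat k * f) \<alpha> = of_nat k * Poly_Mapping.lookup (f :: (nat \<Rightarrow>\<^sub>0 nat) \<Rightarrow>\<^sub>0 real) \<alpha>"
  by (induction k) (simp_all add: lookup_add algebra_simps)

section \<open>Polynomials in finitely many variables as truncated symmetric functions\<close>

definition var :: "nat \<Rightarrow> (nat \<Rightarrow>\<^sub>0 nat) \<Rightarrow>\<^sub>0 real" where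
  "var i = Poly_Mapping.single (Poly_Mapping.single i 1) 1"

lemma prod_var:
  "(\<Prod>v\<in>V. var (\<kappa> v)) = Poly_Mapping.single (\<Sum>v\<in>V. Poly_Mapping.single (\<kappa> v) 1) 1"
  by (induction V rule: infinite_finite_induct) (simp_all add: var_def mult_single)

lemma lookup_sum_single:
  "finite V \<Longrightarrow> Poly_Mapping.lookup (\<Sum>v\<in>V. Poly_Mapping.single (\<kappa> v) (1 :: nat)) i = card {v \<in> V. \<kappa> v = i}"
  by (simp add: lookup_sum lookup_single when_def sum.If_cases Int_def)

lemma lookup_prod_var:
  assumes "finite V"
  shows "Poly_Mapping.lookup (\<Prod>v\<in>V. var (\<kappa> v)) \<alpha> = (if \<forall>i. card {v \<in> V. \<kappa> v = i} = Poly_Mapping.lookup \<alpha> i then 1 else 0)"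
  using assms by (simp add: prod_var lookup_single when_def poly_mapping_eq_iff fun_eq_iff lookup_sum_single
    del: One_nat_def)

interpretation poly: color_weights "{..<N}" var for N
  by standard simp

text \<open>A set \<open>S\<close> yields the monomial \<alpha> only if \<alpha> is the indicator of
  \<open>S\<close>, so only its support can contribute; the hypothesis puts that support among the
  \<open>N\<close> colours.\<close>

lemma lookup_esym:
  assumes "Poly_Mapping.keys \<alpha> \<subseteq> {..<N}"
  shows "Poly_Mapping.lookup (poly.esym {..<N} k) \<alpha> = elem_sf k \<alpha>"
proof -
  have "Poly_Mapping.lookup (poly.esym {..<N} k) \<alpha> = (\<Sum>S | S \<subseteq> {..<N} \<and> card S = k. Poly_Mapping.lookup (\<Prod>i\<in>S. var i) \<alpha>)"
    by (simp add: poly.esym_def lookup_sum)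
  also have "\<dots> = (\<Sum>S | S \<subseteq> {..<N} \<and> card S = k.
      if S = Poly_Mapping.keys \<alpha> then if \<forall>i. Poly_Mapping.lookup \<alpha> i \<le> 1 then 1 else 0 else 0)"
  proof (intro sum.cong refl)
    fix S assume "S \<in> {S. S \<subseteq> {..<N} \<and> card S = k}"
    then have fin: "finite S" using finite_subset by blast
    have c: "card {v \<in> S. v = i} = (if i \<in> S then 1 else 0)" for i
    proof -
      have "{v \<in> S. v = i} = (if i \<in> S then {i} else {})" by auto
      then show ?thesis by simp
    qed
    have "(\<forall>i. (if i \<in> S then 1 else 0) = Poly_Mapping.lookup \<alpha> i) \<longleftrightarrow> (\<forall>i. Poly_Mapping.lookup \<alpha> i \<le> 1) \<and> S = Poly_Mapping.keys \<alpha>"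
    proof
      assume *: "\<forall>i. (if i \<in> S then 1 else 0) = Poly_Mapping.lookup \<alpha> i"
      then have "Poly_Mapping.lookup \<alpha> i \<le> 1" "i \<in> S \<longleftrightarrow> i \<in> Poly_Mapping.keys \<alpha>" for i
        by (auto simp: in_keys_iff dest: spec[of _ i] split: if_splits)
      then show "(\<forall>i. Poly_Mapping.lookup \<alpha> i \<le> 1) \<and> S = Poly_Mapping.keys \<alpha>" by blast
    next
      assume *: "(\<forall>i. Poly_Mapping.lookup \<alpha> i \<le> 1) \<and> S = Poly_Mapping.keys \<alpha>"
      show "\<forall>i. (if i \<in> S then 1 else 0) = Poly_Mapping.lookup \<alpha> i"
      proof
        fix i
        from * have "Poly_Mapping.lookup \<alpha> i \<le> 1" "S = Poly_Mapping.keys \<alpha>" by auto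
        then show "(if i \<in> S then 1 else 0) = Poly_Mapping.lookup \<alpha> i"
          by (cases "Poly_Mapping.lookup \<alpha> i = 0") (auto simp: in_keys_iff)
      qed
    qed
    then show "Poly_Mapping.lookup (\<Prod>i\<in>S. var i) \<alpha>
        = (if S = Poly_Mapping.keys \<alpha> then if \<forall>i. Poly_Mapping.lookup \<alpha> i \<le> 1 then 1 else 0 else 0)"
      using lookup_prod_var[OF fin, of "\<lambda>i. i" \<alpha>] unfolding c by auto
  qed
  also have "\<dots> = (if (\<forall>i. Poly_Mapping.lookup \<alpha> i \<le> 1) \<and> card (Poly_Mapping.keys \<alpha>) = k then 1 else 0)"
    using assms by simp
  also have "\<dots> = elem_sf k \<alpha>"
  proof -
    have "(\<Sum>i\<in>Poly_Mapping.keys \<alpha>. Poly_Mapping.lookup \<alpha> i) = card (Poly_Mapping.keys \<alpha>)" if le: "\<forall>i. Poly_Mapping.lookup \<alpha> i \<le> 1"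
    proof -
      have "Poly_Mapping.lookup \<alpha> i = 1" if "i \<in> Poly_Mapping.keys \<alpha>" for i
        using that le[rule_format, of i] by (auto simp: in_keys_iff)
      then show ?thesis by simp
    qed
    then show ?thesis by (auto simp: elem_sf_def)
  qed
  finally show ?thesis .
qed

text \<open>Exponents do not cancel: if \<beta> + \<gamma> = \<alpha>, both are supported inside
  \<alpha>, so the bound on the variables passes to the factors.\<close>

lemma lookup_ecomp:
  "Poly_Mapping.keys \<alpha> \<subseteq> {..<N} \<Longrightarrow> Poly_Mapping.lookup (poly.ecomp N I) \<alpha> = elem_sf_comp I \<alpha>"
proof (induction I arbitrary: \<alpha>)
  case Nil
  then show ?case by (simp add: elem_sf_comp_def sf_one_def lookup_one when_def)
next
  case (Cons i I)
  have "Poly_Mapping.lookup (poly.esym {..<N} i) \<beta> * Poly_Mapping.lookup (poly.ecomp N I) \<gamma> = elem_sf i \<beta> * elem_sf_comp I \<gamma>"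
    if "\<beta> + \<gamma> = \<alpha>" for \<beta> \<gamma>
  proof -
    have "Poly_Mapping.keys \<beta> \<subseteq> Poly_Mapping.keys \<alpha>" "Poly_Mapping.keys \<gamma> \<subseteq> Poly_Mapping.keys \<alpha>"
      using that by (auto simp: in_keys_iff lookup_add)
    with Cons show ?thesis by (simp add: lookup_esym)
  qed
  then show ?case
    by (simp add: lookup_times_sum elem_sf_comp_def sf_mult_def case_prod_unfold cong: sum.cong_simp)
qed

text \<open>A colouring with class sizes \<alpha> uses only colours in the support of \<alpha>, so
  nothing is lost by allowing only the colours below \<open>N\<close>.\<close>

lemma chrom_sf_lookup:
  assumes "Poly_Mapping.keys \<alpha> \<subseteq> {..<N}"
  shows "chrom_sf {0..<n} E \<alpha>
    = Poly_Mapping.lookup (\<Sum>l | length l = n \<and> set l \<subseteq> {..<N} \<and> (\<forall>i<n. \<forall>j<n. E i j \<longrightarrow> l ! i \<noteq> l ! j).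
        prod_list (map var l)) \<alpha>"
proof -
  let ?K = "{\<kappa> \<in> {0..<n} \<rightarrow>\<^sub>E {..<N}. \<forall>i\<in>{0..<n}. \<forall>j\<in>{0..<n}. E i j \<longrightarrow> \<kappa> i \<noteq> \<kappa> j}"
  let ?L = "{l. length l = n \<and> set l \<subseteq> {..<N} \<and> (\<forall>i<n. \<forall>j<n. E i j \<longrightarrow> l ! i \<noteq> l ! j)}"
  let ?type = "\<lambda>\<kappa>. \<forall>i. card {v \<in> {0..<n}. \<kappa> v = i} = Poly_Mapping.lookup \<alpha> i"
  have finK: "finite ?K" by (rule finite_subset[OF _ finite_PiE[of "{0..<n}" "\<lambda>_. {..<N}"]]) auto
  have "\<kappa> v < N" if "?type \<kappa>" "v < n" for \<kappa> v
  proof -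
    have "card {u \<in> {0..<n}. \<kappa> u = \<kappa> v} \<noteq> 0" using that(2) by auto
    then have "\<kappa> v \<in> Poly_Mapping.keys \<alpha>" using that(1) unfolding in_keys_iff by metis
    with assms show ?thesis by auto
  qed
  then have "{\<kappa> \<in> {0..<n} \<rightarrow>\<^sub>E UNIV. (\<forall>i\<in>{0..<n}. \<forall>j\<in>{0..<n}. E i j \<longrightarrow> \<kappa> i \<noteq> \<kappa> j) \<and> ?type \<kappa>}
      = {\<kappa> \<in> ?K. ?type \<kappa>}"
    by (auto simp: PiE_iff)
  then have "chrom_sf {0..<n} E \<alpha> = (\<Sum>\<kappa>\<in>?K. if ?type \<kappa> then 1 else 0)"
    unfolding chrom_sf_def using finK by (simp add: sum.If_cases Int_def)
  also have "\<dots> = Poly_Mapping.lookup (\<Sum>\<kappa>\<in>?K. \<Prod>v\<in>{0..<n}. var (\<kappa> v)) \<alpha>"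
    by (simp add: lookup_sum lookup_prod_var)
  also have "(\<Sum>\<kappa>\<in>?K. \<Prod>v\<in>{0..<n}. var (\<kappa> v)) = (\<Sum>l\<in>?L. prod_list (map var l))"
  proof (rule sum.reindex_bij_witness[where i = "\<lambda>l. \<lambda>v\<in>{0..<n}. l ! v" and j = "\<lambda>\<kappa>. map \<kappa> [0..<n]"])
    fix \<kappa> assume "\<kappa> \<in> ?K"
    then show "(\<lambda>v\<in>{0..<n}. map \<kappa> [0..<n] ! v) = \<kappa>" "map \<kappa> [0..<n] \<in> ?L"
      by (auto simp: fun_eq_iff PiE_iff extensional_def)
    show "prod_list (map var (map \<kappa> [0..<n])) = (\<Prod>v\<in>{0..<n}. var (\<kappa> v))"
      using prod.distinct_set_conv_list[of "[0..<n]" "\<lambda>v. var (\<kappa> v)"] by (simp add: comp_def)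
  next
    fix l assume "l \<in> ?L"
    then show "map (\<lambda>v\<in>{0..<n}. l ! v) [0..<n] = l" "(\<lambda>v\<in>{0..<n}. l ! v) \<in> ?K"
      using nth_mem by (fastforce intro!: nth_equalityI)+
  qed
  finally show ?thesis .
qed

theorem theorem5p3:
  fixes g h m n :: nat
  assumes "m \<ge> 2" and "n = g + h + m"
  shows "(\<forall>\<alpha>. chrom_sf (pcp_vertices g h m) (pcp_edge g h m) \<alpha> / real (fact (m - 2)) =
            real (m - 1) * elem_sf n \<alpha>
          + (\<Sum>I\<in>{I \<in> compositions n. Theta_comp I (h + 1) \<ge> m - 1}.
               real (m - 2) * real (last I) * real (w_comp (butlast I)) * elem_sf_comp I \<alpha>)
          + (\<Sum>I\<in>{I \<in> compositions n. last I \<ge> m - 1}.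
               (real (last I) - real m + 1) * real (w_comp (butlast I)) * elem_sf_comp I \<alpha>))
      \<and> real (m - 1) \<ge> 0
      \<and> (\<forall>I\<in>{I \<in> compositions n. Theta_comp I (h + 1) \<ge> m - 1}.
            real (m - 2) * real (last I) * real (w_comp (butlast I)) \<ge> 0)
      \<and> (\<forall>I\<in>{I \<in> compositions n. last I \<ge> m - 1}.
            (real (last I) - real m + 1) * real (w_comp (butlast I)) \<ge> 0)"
proof (intro conjI allI ballI)
  fix \<alpha> :: "nat \<Rightarrow>\<^sub>0 nat"
  obtain k where m: "m = Suc (Suc k)" using assms(1) by (metis add_2_eq_Suc le_Suc_ex)
  have n: "n = g + h + Suc (Suc k)" using assms(2) m by simp
  \<comment> \<open>The number of colours is chosen after \<alpha>; comparing one coefficient at a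
    time needs only finitely many variables.\<close>
  obtain N where N: "Poly_Mapping.keys \<alpha> \<subseteq> {..<N}" using finite_nat_set_iff_bounded[of "Poly_Mapping.keys \<alpha>"] by auto
  let ?e = "\<lambda>I. elem_sf_comp I \<alpha>"
  have "chrom_sf (pcp_vertices g h m) (pcp_edge g h m) \<alpha>
      = Poly_Mapping.lookup (of_nat (fact k) * poly.pcp N g h k) \<alpha>"
    unfolding pcp_vertices_def chrom_sf_lookup[OF N] poly.sum_pcp_colorings[symmetric]
    by (simp add: poly.pcp_colorings_def m)
  then have "chrom_sf (pcp_vertices g h m) (pcp_edge g h m) \<alpha> / real (fact (m - 2))
      = Poly_Mapping.lookup (poly.pcp N g h k) \<alpha>"
    by (simp add: lookup_of_nat_times m del: of_nat_fact)
  also have "\<dots> = real (m - 1) * elem_sf n \<alpha>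
      + real k * (\<Sum>I | I \<in> compositions n \<and> psums I \<inter> {h + 1..<h + m} = {}.
          real (last I * w_comp (butlast I)) * ?e I)
      + (\<Sum>I | I \<in> compositions n \<and> Suc k \<le> last I.
          real (last I - Suc k) * (real (w_comp (butlast I)) * ?e I))"
    unfolding poly.pcp_gapsum[OF n] poly.gapsum_def m mult.assoc
    by (simp add: lookup_add lookup_sum lookup_of_nat_times lookup_esym[OF N] lookup_ecomp[OF N]
        del: of_nat_Suc of_nat_diff of_nat_mult)
  also have "real k * (\<Sum>I | I \<in> compositions n \<and> psums I \<inter> {h + 1..<h + m} = {}.
          real (last I * w_comp (butlast I)) * ?e I)
      = (\<Sum>I\<in>{I \<in> compositions n. Theta_comp I (h + 1) \<ge> m - 1}.
          real (m - 2) * real (last I) * real (w_comp (butlast I)) * ?e I)"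
    unfolding sum_distrib_left
  proof (intro sum.cong)
    \<comment> \<open>With \<open>t = h + 1\<close> and \<open>r = m - 1\<close> the forbidden
      interval ends just before \<open>t + r = h + m\<close>.\<close>
    have "psums I \<inter> {h + 1..<h + m} = {} \<longleftrightarrow> Theta_comp I (h + 1) \<ge> m - 1" if "I \<in> compositions n" for I
      using that assms Theta_comp_ge_iff[of "h + 1" I "m - 1"] by (simp add: compositions_def)
    then show "{I \<in> compositions n. psums I \<inter> {h + 1..<h + m} = {}}
        = {I \<in> compositions n. Theta_comp I (h + 1) \<ge> m - 1}" by auto
  qed (simp add: m)
  \<comment> \<open>On this index set the truncated difference \<open>last I - Suc k\<close> is the
    true one, \<open>last I - m + 1\<close>.\<close>
  also have "(\<Sum>I | I \<in> compositions n \<and> Suc k \<le> last I.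
          real (last I - Suc k) * (real (w_comp (butlast I)) * ?e I))
      = (\<Sum>I\<in>{I \<in> compositions n. last I \<ge> m - 1}.
          (real (last I) - real m + 1) * real (w_comp (butlast I)) * ?e I)"
    by (intro sum.cong) (simp_all add: m of_nat_diff mult.assoc)
  finally show "chrom_sf (pcp_vertices g h m) (pcp_edge g h m) \<alpha> / real (fact (m - 2)) =
            real (m - 1) * elem_sf n \<alpha>
          + (\<Sum>I\<in>{I \<in> compositions n. Theta_comp I (h + 1) \<ge> m - 1}.
               real (m - 2) * real (last I) * real (w_comp (butlast I)) * elem_sf_comp I \<alpha>)
          + (\<Sum>I\<in>{I \<in> compositions n. last I \<ge> m - 1}.
               (real (last I) - real m + 1) * real (w_comp (butlast I)) * elem_sf_comp I \<alpha>)"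
    .
next
  fix I assume "I \<in> {I \<in> compositions n. m - 1 \<le> last I}"
  then have "0 \<le> real (last I) - real m + 1" by auto
  then show "0 \<le> (real (last I) - real m + 1) * real (w_comp (butlast I))" by simp
qed simp_all

end
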